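(* Fix a positive integer $k$ and let $G_k(x,y,z)=\sum_{n\ge1}\sum_{m,\ell}p_{n,m,\ell}x^my^\ell z^n$ (as a formal power series). Then $$G_k(x,y,z)=\frac{xz-xz^2+xyz^{k+3}-xyz^{2k+3}}{1-2z+z^2-(x+y)z^{2k+2}+(x+y)z^{2k+3}-xyz^{2k+4}+xyz^{4k+4}}.$$
   Context: The $k$-Skipponacci numbers: $S^{(k)}_n=0$ for $n\le0$, $S^{(k)}_i=i$ for $1\le i\le k+1$, $S^{(k)}_{n+1}=S^{(k)}_n+S^{(k)}_{n-k}$ for $n\ge k+1$. Every integer has a unique far-difference representation $x=\sum_t\epsilon_tS^{(k)}_{n_t}$ ($\epsilon_t\in\{\pm1\}$, distinct indices $n_t\ge1$) with same-sign terms at least $2k+2$ apart in index and opposite-sign terms at least $k+2$ apart. $R_k(n)=S^{(k)}_n+S^{(k)}_{n-2k-2}+S^{(k)}_{n-4k-4}+\cdots$ (positive indices only) for $n>0$, $R_k(n)=0$ for $n\le0$. For $n\ge1$, $p_{n,m,\ell}$ is the number of integers in $(R_k(n-1),R_k(n)]$ whose far-difference representation has exactly $m$ positive and exactly $\ell$ negative summands; $p_{n,m,\ell}=0$ for $n\le0$. *)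

theory Defs
  imports "HOL-Computational_Algebra.Formal_Power_Series"
begin

function skipponacci :: "nat \<Rightarrow> int \<Rightarrow> int" where
  "skipponacci k n =
     (if n \<le> 0 then 0
      else if n \<le> int k + 1 then n
      else skipponacci k (n - 1) + skipponacci k (n - 1 - int k))"
  by pat_completeness auto
termination by (relation "measure (\<lambda>(k, n). nat n)") auto

declare skipponacci.simps [simp del]

text \<open>
  A far-difference representation is encoded by the set \<open>P\<close> of indices carrying the
  sign \<open>+1\<close> and the set \<open>N\<close> of indices carrying the sign \<open>-1\<close>.
\<close>

definition far_difference_rep :: "nat \<Rightarrow> int set \<Rightarrow> int set \<Rightarrow> int \<Rightarrow> bool" where
  "far_difference_rep k P N x \<longleftrightarrow>
     finite P \<and> finite N \<and> P \<inter> N = {} \<and>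
     (\<forall>i \<in> P \<union> N. 1 \<le> i) \<and>
     (\<forall>i \<in> P. \<forall>j \<in> P. i \<noteq> j \<longrightarrow> 2 * int k + 2 \<le> \<bar>i - j\<bar>) \<and>
     (\<forall>i \<in> N. \<forall>j \<in> N. i \<noteq> j \<longrightarrow> 2 * int k + 2 \<le> \<bar>i - j\<bar>) \<and>
     (\<forall>i \<in> P. \<forall>j \<in> N. int k + 2 \<le> \<bar>i - j\<bar>) \<and>
     x = (\<Sum>i\<in>P. skipponacci k i) - (\<Sum>i\<in>N. skipponacci k i)"

definition far_R :: "nat \<Rightarrow> int \<Rightarrow> int" where
  "far_R k n =
     (if n \<le> 0 then 0
      else \<Sum>i | 0 < n - int i * (2 * int k + 2). skipponacci k (n - int i * (2 * int k + 2)))"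

text \<open>
  Far-difference representations are unique, so the existential below speaks about
  \<^emph>\<open>the\<close> representation of \<open>x\<close>.
\<close>

definition far_count :: "nat \<Rightarrow> int \<Rightarrow> nat \<Rightarrow> nat \<Rightarrow> nat" where
  "far_count k n m l =
     (if n \<le> 0 then 0
      else card {x. far_R k (n - 1) < x \<and> x \<le> far_R k n \<and>
                    (\<exists>P N. far_difference_rep k P N x \<and> card P = m \<and> card N = l)})"

text \<open>
  Formal power series in \<open>x, y, z\<close> are nested: series in \<open>z\<close> over series in \<open>x\<close> over
  series in \<open>y\<close>, with rational coefficients.
\<close>

type_synonym fps_xyz = "rat fps fps fps"

abbreviation var_x :: fps_xyz where "var_x \<equiv> fps_const fps_X"
abbreviation var_y :: fps_xyz where "var_y \<equiv> fps_const (fps_const fps_X)"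
abbreviation var_z :: fps_xyz where "var_z \<equiv> fps_X"

text \<open>The coefficient of \<open>z\<^sup>0\<close> is \<open>0\<close> because \<^const>\<open>far_count\<close> vanishes for \<open>n \<le> 0\<close>.\<close>

definition far_G :: "nat \<Rightarrow> fps_xyz" where
  "far_G k = Abs_fps (\<lambda>n. Abs_fps (\<lambda>m. Abs_fps (\<lambda>l. of_nat (far_count k (int n) m l))))"

text \<open>
  The coefficients live in \<^typ>\<open>rat fps fps\<close>, which is not a field; the library quotient
  is nevertheless the genuine one whenever the denominator has constant term \<open>1\<close> in \<open>z\<close>.
\<close>

lemma fps_xyz_eq_divide_iff:
  fixes f g h :: fps_xyz
  assumes "fps_nth g 0 = 1"
  shows "f = h / g \<longleftrightarrow> f * g = h"
proof -
  have inv1: "inverse (1 :: rat fps fps) = 1"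
    by (rule fps_inverse_one') (rule fps_inverse_one)
  have inv: "g * inverse g = 1"
    using fps_right_inverse[of g 1] assms unfolding fps_inverse_def[of g] by (simp add: inv1)
  have div: "h / g = h * inverse g"
    by (rule fps_divide_unit) (simp add: assms)
  have inv': "inverse g * g = 1"
    by (subst mult.commute) (rule inv)
  show ?thesis
  proof
    assume "f = h / g"
    then show "f * g = h"
      by (simp only: div mult.assoc inv' mult_1_right)
  next
    assume "f * g = h"
    then have "h * inverse g = f * (g * inverse g)"
      by (simp only: mult.assoc [symmetric])
    then show "f = h / g"
      by (simp only: div inv mult_1_right)
  qed
qed

end

theory Submission
  imports Defs
begin

text \<open>
  The identity \<open>S\<^sub>n = R(n - 1) + R(n - k - 2) + 1\<close> forces a representation with largest term
  \<open>+S\<^sub>n\<close> to have its value in \<open>(R(n - 1), R(n)]\<close>. These intervals are disjoint, so the value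
  determines the leading term and, after removing it, inductively the whole representation.
  Hence \<open>p\<^bsub>n,m,l\<^esub>\<close> counts representations by leading term. Let \<open>A\<close> and \<open>B\<close> be the series of the
  representations with positive and negative leading term. Increasing the leading index by one
  admits exactly the remainders whose own leading term sits at the minimal permitted distance, so
  \<open>(1 - z) A = x (z + z\<^bsup>2k+2\<^esup> A + z\<^bsup>k+2\<^esup> B)\<close>, and symmetrically for \<open>B\<close> with \<open>x\<close>, \<open>y\<close>
  exchanged. Eliminating \<open>B\<close> gives the formula.
\<close>

section \<open>Skipponacci numbers and the bounds \<open>R\<^sub>k\<close>\<close>

lemma skipponacci_nonpos: "n \<le> 0 \<Longrightarrow> skipponacci k n = 0"
  by (subst skipponacci.simps) simp

lemma skipponacci_small: "0 \<le> n \<Longrightarrow> n \<le> int k + 1 \<Longrightarrow> skipponacci k n = n"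
  by (subst skipponacci.simps) simp

lemma skipponacci_rec:
  assumes "int k + 1 < n"
  shows "skipponacci k n = skipponacci k (n - 1) + skipponacci k (n - 1 - int k)"
  using assms by (subst skipponacci.simps) simp

lemma skipponacci_nonneg: "0 \<le> skipponacci k n"
proof (induction "nat n" arbitrary: n rule: less_induct)
  case less
  consider "n \<le> 0" | "0 < n" "n \<le> int k + 1" | "int k + 1 < n"
    by linarith
  then show ?case
  proof cases
    case 3
    then have "0 \<le> skipponacci k (n - 1)" "0 \<le> skipponacci k (n - 1 - int k)"
      by (auto intro!: less)
    then show ?thesis
      using 3 skipponacci_rec[of k n] by simp
  qed (simp_all add: skipponacci_nonpos skipponacci_small)
qed

lemma skipponacci_step_le: "skipponacci k (n - 1) \<le> skipponacci k n"
proof -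
  consider "n \<le> 0" | "0 < n" "n \<le> int k + 1" | "int k + 1 < n"
    by linarith
  then show ?thesis
  proof cases
    case 3
    then show ?thesis
      using skipponacci_rec[of k n] skipponacci_nonneg[of k "n - 1 - int k"] by simp
  qed (simp_all add: skipponacci_nonpos skipponacci_small)
qed

lemma far_R_nonpos: "n \<le> 0 \<Longrightarrow> far_R k n = 0"
  by (simp add: far_R_def)

text \<open>Splits off the summand \<open>i = 0\<close>; the others shift down by one. For
  \<open>n \<le> 0\<close> both sides vanish, so it may be applied at every index.\<close>

lemma far_R_rec: "far_R k n = skipponacci k n + far_R k (n - 2 * int k - 2)"
proof (cases "n \<le> 0")
  case True
  then show ?thesis
    by (simp add: far_R_nonpos skipponacci_nonpos)
next
  case False
  define d where "d = 2 * int k + 2"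
  define I where "I = (\<lambda>m. {i. 0 < m - int i * d})"
  have d: "1 \<le> d"
    by (simp add: d_def)
  have fin: "finite (I m)" for m
  proof (rule finite_subset)
    show "I m \<subseteq> {..nat m}"
    proof
      fix i assume "i \<in> I m"
      moreover have "int i * 1 \<le> int i * d"
        using d by (intro mult_left_mono) auto
      ultimately show "i \<in> {..nat m}"
        by (simp add: I_def)
    qed
  qed simp
  have I: "I n = insert 0 (Suc ` I (n - d))"
  proof (intro set_eqI iffI)
    fix i assume "i \<in> I n"
    then show "i \<in> insert 0 (Suc ` I (n - d))"
      by (cases i) (auto simp: I_def algebra_simps)
  qed (use False in \<open>auto simp: I_def algebra_simps\<close>)
  have R: "far_R k m = (\<Sum>i\<in>I m. skipponacci k (m - int i * d))" for m
  proof (cases "m \<le> 0")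
    case True
    have "m - int i * d \<le> 0" for i
    proof -
      have "0 \<le> int i * d"
        using d by simp
      then show ?thesis
        using True by linarith
    qed
    then show ?thesis
      using True by (simp add: far_R_nonpos skipponacci_nonpos)
  qed (simp add: far_R_def I_def d_def)
  have "far_R k n = skipponacci k n + (\<Sum>i\<in>Suc ` I (n - d). skipponacci k (n - int i * d))"
    unfolding R I by (subst sum.insert) (auto simp: fin)
  also have "(\<Sum>i\<in>Suc ` I (n - d). skipponacci k (n - int i * d)) = far_R k (n - d)"
    unfolding R by (subst sum.reindex) (auto simp: algebra_simps)
  finally show ?thesis
    by (simp add: d_def algebra_simps)
qed

lemma far_R_step_le: "far_R k (n - 1) \<le> far_R k n"
proof (induction "nat n" arbitrary: n rule: less_induct)
  case less
  show ?case
  proof (cases "n \<le> 0")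
    case False
    then have "far_R k (n - 2 * int k - 2 - 1) \<le> far_R k (n - 2 * int k - 2)"
      by (intro less) auto
    moreover have "n - 1 - 2 * int k - 2 = n - 2 * int k - 2 - 1"
      by simp
    ultimately show ?thesis
      using far_R_rec[of k n] far_R_rec[of k "n - 1"] skipponacci_step_le[of k n] by simp
  qed (simp add: far_R_nonpos)
qed

lemma far_R_mono: "m \<le> n \<Longrightarrow> far_R k m \<le> far_R k n"
proof (induction n rule: int_ge_induct)
  case (step n)
  then show ?case
    using far_R_step_le[of k "n + 1"] by simp
qed simp

lemma far_R_nonneg: "0 \<le> far_R k n"
  using far_R_mono[of "min n 0" n k] far_R_nonpos[of "min n 0" k] by simp

text \<open>For \<open>n > 2k + 2\<close> two uses of the recurrence split the number into those at
  \<open>n - 1\<close>, \<open>n - k - 2\<close> and \<open>n - 2k - 2\<close>. The first two open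
  the \<open>far_R\<close> sums; the induction hypothesis at the third supplies both tails and the
  1.\<close>

lemma skipponacci_eq_far_R:
  assumes "1 \<le> n"
  shows "skipponacci k n = far_R k (n - 1) + far_R k (n - int k - 2) + 1"
  using assms
proof (induction "nat n" arbitrary: n rule: less_induct)
  case less
  note R = far_R_rec[of k "n - 1"] far_R_rec[of k "n - int k - 2"]
  show ?case
  proof (cases "n \<le> 2 * int k + 2")
    \<comment> \<open>In this range each \<open>far_R\<close> sum has at most one term.\<close>
    case True
    then show ?thesis
      using less.prems R skipponacci_rec[of k n] skipponacci_rec[of k "n - 1 - int k"]
        skipponacci_small[of n k] skipponacci_small[of "n - 1" k]
        skipponacci_small[of "n - 1 - int k" k] skipponacci_small[of "n - int k - 2" k]
      by (cases "n \<le> int k + 1") (auto simp: far_R_nonpos skipponacci_nonpos)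
  next
    case False
    have "skipponacci k (n - 2 * int k - 2) =
        far_R k (n - 2 * int k - 2 - 1) + far_R k (n - 2 * int k - 2 - int k - 2) + 1"
      using False by (intro less) auto
    moreover have "n - 1 - 2 * int k - 2 = n - 2 * int k - 2 - 1"
      "n - int k - 2 - 2 * int k - 2 = n - 2 * int k - 2 - int k - 2"
      "n - 1 - int k - 1 = n - int k - 2" "n - 1 - int k - 1 - int k = n - 2 * int k - 2"
      by simp_all
    ultimately show ?thesis
      using False R skipponacci_rec[of k n] skipponacci_rec[of k "n - 1 - int k"]
      by (simp only:)
  qed
qed


section \<open>Representations sorted by their largest index\<close>

text \<open>The index conditions of \<open>far_difference_rep\<close> without the value, so that
  terms can be removed and signs exchanged without tracking the sum.\<close>

definition far_admissible :: "nat \<Rightarrow> int set \<Rightarrow> int set \<Rightarrow> bool" where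
  "far_admissible k P N \<longleftrightarrow>
     finite P \<and> finite N \<and> P \<inter> N = {} \<and>
     (\<forall>i \<in> P \<union> N. 1 \<le> i) \<and>
     (\<forall>i \<in> P. \<forall>j \<in> P. i \<noteq> j \<longrightarrow> 2 * int k + 2 \<le> \<bar>i - j\<bar>) \<and>
     (\<forall>i \<in> N. \<forall>j \<in> N. i \<noteq> j \<longrightarrow> 2 * int k + 2 \<le> \<bar>i - j\<bar>) \<and>
     (\<forall>i \<in> P. \<forall>j \<in> N. int k + 2 \<le> \<bar>i - j\<bar>)"

definition far_value :: "nat \<Rightarrow> int set \<Rightarrow> int set \<Rightarrow> int" where
  "far_value k P N = (\<Sum>i\<in>P. skipponacci k i) - (\<Sum>i\<in>N. skipponacci k i)"

text \<open>The signs get separate bounds because a leading positive term limits the remaining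
  positive and negative indices differently.\<close>

definition far_below :: "nat \<Rightarrow> int \<Rightarrow> int \<Rightarrow> (int set \<times> int set) set" where
  "far_below k p q = {(P, N). far_admissible k P N \<and> (\<forall>i\<in>P. i \<le> p) \<and> (\<forall>i\<in>N. i \<le> q)}"

definition far_lead :: "nat \<Rightarrow> int \<Rightarrow> (int set \<times> int set) set" where
  "far_lead k n = {(P, N). far_admissible k P N \<and> n \<in> P \<and> (\<forall>i\<in>P \<union> N. i \<le> n)}"

lemma far_difference_rep_iff:
  "far_difference_rep k P N x \<longleftrightarrow> far_admissible k P N \<and> x = far_value k P N"
  by (auto simp: far_difference_rep_def far_admissible_def far_value_def)

lemma far_admissible_swap:
  assumes "far_admissible k P N"
  shows "far_admissible k N P"
proof -
  have "\<forall>i\<in>N. \<forall>j\<in>P. int k + 2 \<le> \<bar>i - j\<bar>"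
    using assms by (subst abs_minus_commute) (simp add: far_admissible_def)
  then show ?thesis
    using assms unfolding far_admissible_def Un_commute[of N] Int_commute[of N] by blast
qed

lemma far_value_swap: "far_value k N P = - far_value k P N"
  by (simp add: far_value_def)

lemma far_lead_admissible: "(P, N) \<in> far_lead k n \<Longrightarrow> far_admissible k P N"
  by (simp add: far_lead_def)

lemma far_lead_pos: "(P, N) \<in> far_lead k n \<Longrightarrow> 1 \<le> n"
  by (auto simp: far_lead_def far_admissible_def)

text \<open>A negative lead is recorded as a positive lead of the swapped pair, so the single family
  \<open>far_lead\<close> serves both signs.\<close>

lemma far_admissible_cases:
  assumes "far_admissible k P N"
  obtains (empty) "P = {}" "N = {}"
    | (pos) n where "(P, N) \<in> far_lead k n"
    | (neg) n where "(N, P) \<in> far_lead k n"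
proof (cases "P \<union> N = {}")
  case False
  have fin: "finite (P \<union> N)"
    using assms by (simp add: far_admissible_def)
  define n where "n = Max (P \<union> N)"
  have "n \<in> P \<union> N"
    using False fin unfolding n_def by (rule Max_in[rotated])
  moreover have "\<forall>i\<in>P \<union> N. i \<le> n"
    using fin by (simp add: n_def)
  ultimately show ?thesis
    using pos[of n] neg[of n] assms far_admissible_swap[OF assms]
    by (auto simp: far_lead_def)
qed (use empty in auto)

text \<open>As \<open>n\<close> is the largest index, the distance conditions against it become
  one-sided bounds on the other indices.\<close>

lemma far_lead_remove:
  assumes "(P, N) \<in> far_lead k n"
  shows "(P - {n}, N) \<in> far_below k (n - 2 * int k - 2) (n - int k - 2)"
proof -
  have adm: "far_admissible k P N" and n: "n \<in> P" and le: "\<forall>i\<in>P \<union> N. i \<le> n"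
    using assms by (auto simp: far_lead_def)
  have "i \<le> n - 2 * int k - 2" if "i \<in> P - {n}" for i
  proof -
    have "2 * int k + 2 \<le> \<bar>n - i\<bar>"
      using adm n that by (auto simp: far_admissible_def)
    then show ?thesis
      using le that by auto
  qed
  moreover have "i \<le> n - int k - 2" if "i \<in> N" for i
  proof -
    have "int k + 2 \<le> \<bar>n - i\<bar>"
      using adm n that by (auto simp: far_admissible_def)
    then show ?thesis
      using le that by auto
  qed
  moreover have "far_admissible k (P - {n}) N"
    using adm by (auto simp: far_admissible_def)
  ultimately show ?thesis
    by (simp add: far_below_def)
qed

lemma far_below_insert:
  assumes "(P, N) \<in> far_below k (n - 2 * int k - 2) (n - int k - 2)" "1 \<le> n"
  shows "(insert n P, N) \<in> far_lead k n"
proof -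
  have adm: "far_admissible k P N" and P: "\<And>i. i \<in> P \<Longrightarrow> i \<le> n - 2 * int k - 2"
    and N: "\<And>i. i \<in> N \<Longrightarrow> i \<le> n - int k - 2"
    using assms by (auto simp: far_below_def)
  have "2 * int k + 2 \<le> \<bar>n - i\<bar>" "2 * int k + 2 \<le> \<bar>i - n\<bar>" "i \<le> n" if "i \<in> P" for i
    using P[OF that] by auto
  moreover have "int k + 2 \<le> \<bar>n - i\<bar>" "i \<le> n" if "i \<in> N" for i
    using N[OF that] by auto
  moreover have "n \<notin> N"
    using N by fastforce
  ultimately show ?thesis
    using adm assms(2) unfolding far_lead_def far_admissible_def by auto
qed

lemma far_lead_eq_image:
  assumes "1 \<le> n"
  shows "far_lead k n =
    (\<lambda>(P, N). (insert n P, N)) ` far_below k (n - 2 * int k - 2) (n - int k - 2)"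
proof (intro equalityI subsetI)
  fix X assume X: "X \<in> far_lead k n"
  obtain P N where PN: "X = (P, N)"
    by (cases X)
  then have "X = (\<lambda>(P, N). (insert n P, N)) (P - {n}, N)"
    using X by (auto simp: far_lead_def)
  then show "X \<in> (\<lambda>(P, N). (insert n P, N)) ` far_below k (n - 2 * int k - 2) (n - int k - 2)"
    using far_lead_remove X unfolding PN by blast
qed (use far_below_insert assms in auto)

lemma inj_on_insert_far_below:
  "inj_on (\<lambda>(P, N). (insert n P, N)) (far_below k (n - 2 * int k - 2) (n - int k - 2))"
proof (rule inj_onI)
  fix X Y
  assume X: "X \<in> far_below k (n - 2 * int k - 2) (n - int k - 2)"
    and Y: "Y \<in> far_below k (n - 2 * int k - 2) (n - int k - 2)"
    and eq: "(\<lambda>(P, N). (insert n P, N)) X = (\<lambda>(P, N). (insert n P, N)) Y"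
  have "n \<notin> fst X" "n \<notin> fst Y"
    using X Y by (fastforce simp: far_below_def)+
  then show "X = Y"
    using eq by (cases X; cases Y) (auto dest: insert_ident)
qed

lemma far_below_finite: "finite (far_below k p q)"
proof (rule finite_subset)
  show "far_below k p q \<subseteq> Pow {1..p} \<times> Pow {1..q}"
    by (auto simp: far_below_def far_admissible_def)
qed simp

lemma far_lead_finite: "finite (far_lead k n)"
proof (rule finite_subset)
  show "far_lead k n \<subseteq> far_below k n n"
    by (auto simp: far_below_def far_lead_def)
qed (rule far_below_finite)

section \<open>Value intervals and uniqueness of representations\<close>

lemma far_value_remove:
  assumes "(P, N) \<in> far_lead k n"
  shows "far_value k P N = skipponacci k n + far_value k (P - {n}) N"
proof -
  have "finite P" "n \<in> P"
    using assms by (auto simp: far_lead_def far_admissible_def)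
  then show ?thesis
    unfolding far_value_def by (subst sum.remove[of P n]) simp_all
qed

text \<open>By induction the remainder has value between \<open>- far_R k (n - k - 2)\<close> and
  \<open>far_R k (n - 2k - 2)\<close>. Adding the leading number turns these ends into
  \<open>far_R k (n - 1) + 1\<close> by \<open>skipponacci_eq_far_R\<close> and
  \<open>far_R k n\<close> by \<open>far_R_rec\<close>.\<close>

lemma far_lead_value_bounds:
  assumes "(P, N) \<in> far_lead k n"
  shows "far_R k (n - 1) < far_value k P N \<and> far_value k P N \<le> far_R k n"
  using assms
proof (induction "nat n" arbitrary: n P N rule: less_induct)
  case less
  define Q where "Q = P - {n}"
  have n: "1 \<le> n"
    using less.prems by (rule far_lead_pos)
  have Q: "far_admissible k Q N" "\<And>i. i \<in> Q \<Longrightarrow> i \<le> n - 2 * int k - 2"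
      "\<And>i. i \<in> N \<Longrightarrow> i \<le> n - int k - 2"
    using far_lead_remove[OF less.prems] by (auto simp: far_below_def Q_def)
  have rest: "- far_R k (n - int k - 2) \<le> far_value k Q N \<and>
      far_value k Q N \<le> far_R k (n - 2 * int k - 2)"
    using Q(1)
  proof (cases rule: far_admissible_cases)
    case empty
    then show ?thesis
      using far_R_nonneg by (simp add: far_value_def)
  next
    case (pos j)
    then have j: "j \<le> n - 2 * int k - 2"
      using Q(2) by (auto simp: far_lead_def)
    then have "far_R k (j - 1) < far_value k Q N \<and> far_value k Q N \<le> far_R k j"
      using n pos by (intro less.hyps) auto
    then show ?thesis
      using far_R_mono[OF j, of k] far_R_nonneg[of k "j - 1"] far_R_nonneg[of k "n - int k - 2"]
      by linarith
  next
    case (neg j)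
    then have j: "j \<le> n - int k - 2"
      using Q(3) by (auto simp: far_lead_def)
    then have "far_R k (j - 1) < far_value k N Q \<and> far_value k N Q \<le> far_R k j"
      using n neg by (intro less.hyps) auto
    then show ?thesis
      using far_R_mono[OF j, of k] far_R_nonneg[of k "j - 1"]
        far_R_nonneg[of k "n - 2 * int k - 2"] far_value_swap[of k N Q]
      by linarith
  qed
  then show ?case
    using far_value_remove[OF less.prems] far_R_rec[of k n] skipponacci_eq_far_R[OF n, of k]
    unfolding Q_def by linarith
qed

lemma far_lead_value_pos: "(P, N) \<in> far_lead k n \<Longrightarrow> 0 < far_value k P N"
  using far_lead_value_bounds[of P N k n] far_R_nonneg[of k "n - 1"] by linarith

lemma far_R_interval_unique:
  assumes "far_R k (m - 1) < x" "x \<le> far_R k m" "far_R k (n - 1) < x" "x \<le> far_R k n"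
  shows "m = n"
  using assms far_R_mono[of m "n - 1" k] far_R_mono[of n "m - 1" k] by linarith

text \<open>Empty and negative-led pairs have value at most 0 and miss the interval; for a positive
  lead, disjointness of the intervals fixes the index.\<close>

lemma far_value_pos_lead:
  assumes "far_admissible k P N" "far_R k (n - 1) < far_value k P N" "far_value k P N \<le> far_R k n"
  shows "(P, N) \<in> far_lead k n"
  using assms(1)
proof (cases rule: far_admissible_cases)
  case empty
  then show ?thesis
    using assms(2) far_R_nonneg[of k "n - 1"] by (simp add: far_value_def)
next
  case (pos m)
  then have "m = n"
    using far_lead_value_bounds assms(2,3) by (intro far_R_interval_unique) auto
  then show ?thesis
    using pos by simp
next
  case (neg m)
  then show ?thesis
    using far_lead_value_pos[OF neg] assms(2) far_R_nonneg[of k "n - 1"] far_value_swap[of k N P]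
    by linarith
qed

text \<open>Equal values force the same leading term, and deleting it leaves smaller pairs with
  equal values.\<close>

lemma far_value_inject:
  assumes "far_admissible k P N" "far_admissible k P' N'" "far_value k P N = far_value k P' N'"
  shows "P = P' \<and> N = N'"
  using assms
proof (induction "card (P \<union> N)" arbitrary: P N P' N' rule: less_induct)
  case less
  \<comment> \<open>Stated through \<open>A \<union> B = P \<union> N\<close> so that it covers both
    signs: \<open>A\<close>, \<open>B\<close> may be \<open>P\<close>, \<open>N\<close> or
    \<open>N\<close>, \<open>P\<close>, with the same induction measure.\<close>
  have lead: "A = A' \<and> B = B'"
    if lead: "(A, B) \<in> far_lead k n" and adm: "far_admissible k A' B'"
      and val: "far_value k A B = far_value k A' B'" and un: "A \<union> B = P \<union> N"
    for A B A' B' n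
  proof -
    have lead': "(A', B') \<in> far_lead k n"
      using far_value_pos_lead[OF adm] far_lead_value_bounds[OF lead] val by simp
    have nin: "n \<in> A" "n \<in> A'" "n \<notin> B"
      using lead lead' by (auto simp: far_lead_def far_admissible_def)
    have "(A - {n}) \<union> B = (P \<union> N) - {n}" "n \<in> P \<union> N"
      using un nin by auto
    moreover have "finite (P \<union> N)"
      using less.prems(1) by (simp add: far_admissible_def)
    ultimately have "card ((A - {n}) \<union> B) < card (P \<union> N)"
      by (metis card_Diff1_less)
    moreover have "far_admissible k (A - {n}) B" "far_admissible k (A' - {n}) B'"
      using far_lead_remove[OF lead] far_lead_remove[OF lead'] by (auto simp: far_below_def)
    moreover have "far_value k (A - {n}) B = far_value k (A' - {n}) B'"
      using far_value_remove[OF lead] far_value_remove[OF lead'] val by simp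
    ultimately have "A - {n} = A' - {n} \<and> B = B'"
      by (rule less.hyps)
    then show ?thesis
      using nin by blast
  qed
  show ?case
    using less.prems(1)
  proof (cases rule: far_admissible_cases)
    case empty
    then have "far_value k P' N' = 0"
      using less.prems(3) by (simp add: far_value_def)
    then have "(P', N') \<notin> far_lead k n" "(N', P') \<notin> far_lead k n" for n
      using far_lead_value_pos[of P' N' k n] far_lead_value_pos[of N' P' k n]
        far_value_swap[of k N' P']
      by auto
    then have "P' = {} \<and> N' = {}"
      using far_admissible_cases[OF less.prems(2)] by metis
    then show ?thesis
      using empty by simp
  next
    case (pos n)
    then show ?thesis
      using lead less.prems by blast
  next
    case (neg n)
    have "far_value k N P = far_value k N' P'"
      using less.prems(3) far_value_swap[of k N P] far_value_swap[of k N' P'] by simp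
    then show ?thesis
      using lead[OF neg far_admissible_swap[OF less.prems(2)]] by blast
  qed
qed

text \<open>Evaluation maps the pairs led by \<open>n\<close> bijectively to the counted integers:
  onto by \<open>far_value_pos_lead\<close>, one-to-one by \<open>far_value_inject\<close>.\<close>

lemma far_count_eq_card_far_lead:
  "far_count k n m l = card {(P, N) \<in> far_lead k n. card P = m \<and> card N = l}"
proof (cases "n \<le> 0")
  case True
  then have "far_lead k n = {}"
    using far_lead_pos[of _ _ k n] by force
  then show ?thesis
    using True by (simp add: far_count_def)
next
  case False
  let ?L = "{(P, N) \<in> far_lead k n. card P = m \<and> card N = l}"
  have "{x. far_R k (n - 1) < x \<and> x \<le> far_R k n \<and>
      (\<exists>P N. far_difference_rep k P N x \<and> card P = m \<and> card N = l)} =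
      (\<lambda>(P, N). far_value k P N) ` ?L" (is "?X = ?Y")
  proof
    show "?X \<subseteq> ?Y"
      using far_value_pos_lead by (fastforce simp: far_difference_rep_iff)
    show "?Y \<subseteq> ?X"
      using far_lead_value_bounds far_lead_admissible by (fastforce simp: far_difference_rep_iff)
  qed
  moreover have "inj_on (\<lambda>(P, N). far_value k P N) ?L"
    by (rule inj_onI) (use far_value_inject far_lead_admissible in \<open>clarsimp, blast\<close>)
  ultimately show ?thesis
    using False by (simp add: far_count_def card_image)
qed


section \<open>Weighted enumeration\<close>

text \<open>Generating polynomial with \<open>u\<close> marking positive and \<open>v\<close>
  negative terms; exchanging them amounts to reversing all signs.\<close>

definition far_weight :: "'a :: comm_ring_1 \<Rightarrow> 'a \<Rightarrow> (int set \<times> int set) set \<Rightarrow> 'a" where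
  "far_weight u v S = (\<Sum>(P, N)\<in>S. u ^ card P * v ^ card N)"

lemma far_weight_swap: "far_weight u v (prod.swap ` S) = far_weight v u S"
  unfolding far_weight_def
  by (subst sum.reindex) (auto intro!: sum.cong simp: mult.commute)

text \<open>
  The indices \<open>p\<close> (positive) and \<open>p + k\<close> (negative) are closer than \<open>k + 2\<close>, so at most one of them
  occurs, and whichever does is the largest index.
\<close>

lemma far_below_step:
  "far_below k p (p + int k) =
     far_below k (p - 1) (p - 1 + int k) \<union> (far_lead k p \<union> prod.swap ` far_lead k (p + int k))"
  (is "?L = ?R")
proof (intro equalityI subsetI)
  fix X assume X: "X \<in> ?L"
  obtain P N where PN: "X = (P, N)"
    by (cases X)
  have adm: "far_admissible k P N" and P: "\<And>i. i \<in> P \<Longrightarrow> i \<le> p"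
    and N: "\<And>i. i \<in> N \<Longrightarrow> i \<le> p + int k"
    using X PN by (auto simp: far_below_def)
  consider "p \<in> P" | "p + int k \<in> N" | "p \<notin> P" "p + int k \<notin> N"
    by blast
  then show "X \<in> ?R"
  proof cases
    case 1
    have "i \<le> p" if "i \<in> N" for i
    proof -
      have "int k + 2 \<le> \<bar>p - i\<bar>"
        using adm 1 that by (auto simp: far_admissible_def)
      then show ?thesis
        using N[OF that] by linarith
    qed
    then show ?thesis
      using 1 adm P PN by (auto simp: far_lead_def)
  next
    case 2
    then have "(N, P) \<in> far_lead k (p + int k)"
      using far_admissible_swap[OF adm] P N by (force simp: far_lead_def)
    then show ?thesis
      unfolding PN by force
  next
    case 3
    have "i \<le> p - 1" if "i \<in> P" for i
      using P[OF that] 3 that by (cases "i = p") auto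
    moreover have "i \<le> p - 1 + int k" if "i \<in> N" for i
      using N[OF that] 3 that by (cases "i = p + int k") auto
    ultimately show ?thesis
      using adm PN by (auto simp: far_below_def)
  qed
next
  fix X assume X: "X \<in> ?R"
  obtain P N where PN: "X = (P, N)"
    by (cases X)
  consider "X \<in> far_below k (p - 1) (p - 1 + int k)" | "(P, N) \<in> far_lead k p"
    | "(N, P) \<in> far_lead k (p + int k)"
    using X PN by auto
  then show "X \<in> ?L"
  proof cases
    case 3
    then have "i \<le> p" if "i \<in> P" for i
      using far_lead_remove[OF 3] that by (auto simp: far_below_def)
    then show ?thesis
      using 3 far_admissible_swap unfolding PN by (auto simp: far_lead_def far_below_def)
  qed (force simp: PN far_below_def far_lead_def)+
qed

lemma far_weight_below_step:
  "far_weight u v (far_below k p (p + int k)) =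
     far_weight u v (far_below k (p - 1) (p - 1 + int k)) +
     (far_weight u v (far_lead k p) + far_weight v u (far_lead k (p + int k)))"
proof -
  have "far_lead k p \<inter> prod.swap ` far_lead k (p + int k) = {}"
  proof (rule ccontr)
    assume "far_lead k p \<inter> prod.swap ` far_lead k (p + int k) \<noteq> {}"
    then obtain P N where "(P, N) \<in> far_lead k p" "(N, P) \<in> far_lead k (p + int k)"
      by auto
    \<comment> \<open>Here \<open>p\<close> would be a positive and \<open>p + k\<close> a negative
      index, at distance only \<open>k\<close>.\<close>
    then have "int k + 2 \<le> \<bar>p - (p + int k)\<bar>"
      unfolding far_lead_def far_admissible_def by blast
    then show False
      by simp
  qed
  moreover have "far_below k (p - 1) (p - 1 + int k) \<inter>
      (far_lead k p \<union> prod.swap ` far_lead k (p + int k)) = {}"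
    by (fastforce simp: far_below_def far_lead_def)
  ultimately show ?thesis
    unfolding far_below_step[of k p] far_weight_swap[of u v "far_lead k (p + int k)", symmetric]
    by (simp add: far_weight_def sum.union_disjoint far_below_finite far_lead_finite)
qed

lemma far_weight_lead_eq_below:
  assumes "1 \<le> n"
  shows "far_weight u v (far_lead k n) =
    u * far_weight u v (far_below k (n - 2 * int k - 2) (n - int k - 2))"
proof -
  have card: "card (insert n P) = Suc (card P)"
    if "(P, N) \<in> far_below k (n - 2 * int k - 2) (n - int k - 2)" for P N
  proof -
    have "finite P" "n \<notin> P"
      using that by (auto simp: far_below_def far_admissible_def)
    then show ?thesis
      by simp
  qed
  show ?thesis
    unfolding far_lead_eq_image[OF assms] far_weight_def sum_distrib_left
    by (subst sum.reindex[OF inj_on_insert_far_below])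
      (auto intro!: sum.cong simp: card mult.assoc)
qed

lemma far_weight_lead_nonpos: "n \<le> 0 \<Longrightarrow> far_weight u v (far_lead k n) = 0"
proof -
  assume "n \<le> 0"
  then have "far_lead k n = {}"
    using far_lead_pos[of _ _ k n] by force
  then show ?thesis
    by (simp add: far_weight_def)
qed

text \<open>At \<open>n = 1\<close> both bounds on the remainder are negative, so the leading term
  stands alone; this seeds the recursion.\<close>

lemma far_weight_lead_1: "far_weight u v (far_lead k 1) = u"
proof -
  have "far_below k (1 - 2 * int k - 2) (1 - int k - 2) = {({}, {})}"
  proof (intro equalityI subsetI)
    fix X assume X: "X \<in> far_below k (1 - 2 * int k - 2) (1 - int k - 2)"
    obtain P N where PN: "X = (P, N)"
      by (cases X)
    have False if "i \<in> P \<union> N" for i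
    proof -
      have "1 \<le> i" "i \<le> 1 - int k - 2"
        using X PN that by (fastforce simp: far_below_def far_admissible_def)+
      then show False
        by linarith
    qed
    then show "X \<in> {({}, {})}"
      using PN by blast
  qed (simp add: far_below_def far_admissible_def)
  then show ?thesis
    using far_weight_lead_eq_below[of 1 u v k] by (simp add: far_weight_def)
qed

text \<open>Difference of \<open>far_weight_lead_eq_below\<close> at \<open>n\<close> and
  \<open>n - 1\<close>, both positive by hypothesis. The two remainder families are consecutive in
  \<open>far_weight_below_step\<close> with \<open>p = n - 2k - 2\<close>, as
  \<open>p + k = n - k - 2\<close>.\<close>

lemma far_weight_lead_rec:
  assumes "2 \<le> n"
  shows "far_weight u v (far_lead k n) = far_weight u v (far_lead k (n - 1)) +
    u * (far_weight u v (far_lead k (n - 2 * int k - 2)) +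
         far_weight v u (far_lead k (n - int k - 2)))"
proof -
  have e: "n - 2 * int k - 2 + int k = n - int k - 2"
    "n - 2 * int k - 2 - 1 + int k = n - 1 - int k - 2"
    "n - 2 * int k - 2 - 1 = n - 1 - 2 * int k - 2"
    by simp_all
  show ?thesis
    using assms far_weight_below_step[of u v k "n - 2 * int k - 2", unfolded e]
      far_weight_lead_eq_below[of n u v k] far_weight_lead_eq_below[of "n - 1" u v k]
    by (simp add: algebra_simps)
qed

section \<open>Generating series, their functional equations and elimination\<close>

definition far_series :: "nat \<Rightarrow> 'a :: comm_ring_1 \<Rightarrow> 'a \<Rightarrow> 'a fps" where
  "far_series k u v = Abs_fps (\<lambda>n. far_weight u v (far_lead k (int n)))"

lemma far_series_eq:
  "(1 - fps_X) * far_series k u v = fps_const u * (fps_X +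
     fps_X ^ (2 * k + 2) * far_series k u v + fps_X ^ (k + 2) * far_series k v u)"
proof (rule fps_ext)
  fix n
  \<comment> \<open>The subtraction is in the integers: for \<open>n < j\<close> the index is
    negative and the weight 0, matching the coefficient of the shifted series.\<close>
  have a: "fps_nth (fps_X ^ j * far_series k u v) n = far_weight u v (far_lead k (int n - int j))"
    for j and u v :: 'a
    by (simp add: fps_X_power_mult_nth far_series_def far_weight_lead_nonpos of_nat_diff)
  have b: "fps_nth ((1 - fps_X) * far_series k u v) n =
      far_weight u v (far_lead k (int n)) - far_weight u v (far_lead k (int n - 1))"
    using a[of 1 u v] by (simp add: left_diff_distrib far_series_def)
  \<comment> \<open>The indicator is the coefficient of the lone \<open>fps_X\<close>, accounting
    for the one-term representation at \<open>n = 1\<close>.\<close>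
  have c: "far_weight u v (far_lead k (int n)) - far_weight u v (far_lead k (int n - 1)) =
      u * ((if n = 1 then 1 else 0) + far_weight u v (far_lead k (int n - int (2 * k + 2))) +
           far_weight v u (far_lead k (int n - int (k + 2))))"
  proof (cases "n \<le> 1")
    case True
    then have "n = 0 \<or> n = 1"
      by linarith
    then show ?thesis
      by (auto simp: far_weight_lead_nonpos far_weight_lead_1)
  next
    case False
    have "int n - int (2 * k + 2) = int n - 2 * int k - 2" "int n - int (k + 2) = int n - int k - 2"
      by simp_all
    then show ?thesis
      using False far_weight_lead_rec[of "int n" u v k] by (simp only:) simp
  qed
  show "fps_nth ((1 - fps_X) * far_series k u v) n = fps_nth (fps_const u * (fps_X +
     fps_X ^ (2 * k + 2) * far_series k u v + fps_X ^ (k + 2) * far_series k v u)) n"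
    unfolding b c by (simp only: fps_mult_left_const_nth fps_add_nth a fps_X_nth)
qed

text \<open>Each pair contributes one monomial in \<open>x\<close> and \<open>y\<close>, whose
  coefficient at \<open>m\<close>, \<open>l\<close> tests the two cardinalities; summing counts the
  pairs.\<close>

lemma far_G_eq_far_series: "far_G k = far_series k fps_X (fps_const fps_X)"
proof (intro fps_ext)
  fix n m l
  have "fps_nth (fps_nth (fps_X ^ a * fps_const fps_X ^ b :: rat fps fps) m) l =
      (if a = m \<and> b = l then 1 else 0)" for a b
    by (auto simp: fps_const_power fps_X_power_mult_nth fps_X_power_nth)
  then have "fps_nth (fps_nth (far_weight fps_X (fps_const fps_X) (far_lead k (int n))) m) l =
      (\<Sum>(P, N)\<in>far_lead k (int n). if card P = m \<and> card N = l then 1 else 0 :: rat)"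
    by (simp add: far_weight_def fps_sum_nth case_prod_beta)
  also have "\<dots> = of_nat (card {(P, N) \<in> far_lead k (int n). card P = m \<and> card N = l})"
    by (simp add: case_prod_beta sum.If_cases far_lead_finite Int_def)
      (auto intro!: arg_cong[where f = card])
  finally show "fps_nth (fps_nth (fps_nth (far_G k) n) m) l =
      fps_nth (fps_nth (fps_nth (far_series k fps_X (fps_const fps_X)) n) m) l"
    by (simp add: far_G_def far_series_def far_count_eq_card_far_lead)
qed

text \<open>Here \<open>w\<close> stands for \<open>z ^ k\<close>, so that all exponents are
  numerals and polynomial normalization applies.\<close>

lemma eliminate_series:
  fixes A B x y z w :: "'a :: comm_ring_1"
  assumes A: "(1 - z) * A = x * (z + w ^ 2 * z ^ 2 * A + w * z ^ 2 * B)"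
    and B: "(1 - z) * B = y * (z + w ^ 2 * z ^ 2 * B + w * z ^ 2 * A)"
  shows "A * (1 - 2 * z + z ^ 2 - (x + y) * (w ^ 2 * z ^ 2)
       + (x + y) * (w ^ 2 * z ^ 3) - x * y * (w ^ 2 * z ^ 4) + x * y * (w ^ 4 * z ^ 4)) =
     x * z - x * z ^ 2 + x * y * (w * z ^ 3) - x * y * (w ^ 2 * z ^ 3)"
proof -
  \<comment> \<open>The factor of \<open>B\<close> in the second equation. Multiplying the first by
    \<open>D\<close> makes \<open>B\<close> occur only as \<open>D * B\<close>, so elimination
    proceeds without division.\<close>
  define D where "D = 1 - z - y * w ^ 2 * z ^ 2"
  have A': "(1 - z - x * w ^ 2 * z ^ 2) * A = x * z + x * w * z ^ 2 * B"
    using A by (simp add: algebra_simps)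
  have B': "D * B = y * z + y * w * z ^ 2 * A"
    using B by (simp add: D_def algebra_simps)
  have "A * (1 - 2 * z + z ^ 2 - (x + y) * (w ^ 2 * z ^ 2)
       + (x + y) * (w ^ 2 * z ^ 3) - x * y * (w ^ 2 * z ^ 4) + x * y * (w ^ 4 * z ^ 4)) =
      D * ((1 - z - x * w ^ 2 * z ^ 2) * A) - x * y * w ^ 2 * z ^ 4 * A"
    by (simp add: D_def algebra_simps power2_eq_square power3_eq_cube power4_eq_xxxx)
  also have "\<dots> = D * (x * z) + x * w * z ^ 2 * (D * B) - x * y * w ^ 2 * z ^ 4 * A"
    unfolding A' by (simp add: algebra_simps)
  also have "\<dots> = x * z - x * z ^ 2 + x * y * (w * z ^ 3) - x * y * (w ^ 2 * z ^ 3)"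
    unfolding B' by (simp add: D_def algebra_simps power2_eq_square power3_eq_cube power4_eq_xxxx)
  finally show ?thesis .
qed

theorem theorem3p2:
  fixes k :: nat
  assumes "k \<ge> 1"
  shows "far_G k =
    (var_x * var_z - var_x * var_z ^ 2 + var_x * var_y * var_z ^ (k + 3)
       - var_x * var_y * var_z ^ (2 * k + 3)) /
    (1 - 2 * var_z + var_z ^ 2 - (var_x + var_y) * var_z ^ (2 * k + 2)
       + (var_x + var_y) * var_z ^ (2 * k + 3) - var_x * var_y * var_z ^ (2 * k + 4)
       + var_x * var_y * var_z ^ (4 * k + 4))"
\<comment> \<open>The denominator has constant term 1 in \<open>z\<close>, checked by the closing
  \<open>simp\<close>, so the quotient becomes a product identity.\<close>
proof (subst fps_xyz_eq_divide_iff)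
  define A :: fps_xyz where "A = far_series k fps_X (fps_const fps_X)"
  define B :: fps_xyz where "B = far_series k (fps_const fps_X) fps_X"
  define w :: fps_xyz where "w = var_z ^ k"
  have pow: "var_z ^ (k + 2) = w * var_z ^ 2" "var_z ^ (k + 3) = w * var_z ^ 3"
    "var_z ^ (2 * k + 2) = w ^ 2 * var_z ^ 2" "var_z ^ (2 * k + 3) = w ^ 2 * var_z ^ 3"
    "var_z ^ (2 * k + 4) = w ^ 2 * var_z ^ 4" "var_z ^ (4 * k + 4) = w ^ 4 * var_z ^ 4"
    by (simp_all add: w_def power_add power_mult[symmetric] mult.commute flip: power2_eq_square)
  show "far_G k * (1 - 2 * var_z + var_z ^ 2 - (var_x + var_y) * var_z ^ (2 * k + 2)
       + (var_x + var_y) * var_z ^ (2 * k + 3) - var_x * var_y * var_z ^ (2 * k + 4)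
       + var_x * var_y * var_z ^ (4 * k + 4)) =
     var_x * var_z - var_x * var_z ^ 2 + var_x * var_y * var_z ^ (k + 3)
       - var_x * var_y * var_z ^ (2 * k + 3)"
    unfolding far_G_eq_far_series pow A_def[symmetric]
    \<comment> \<open>\<open>B\<close> is given explicitly since it does not occur in the goal; both
      premises are \<open>far_series_eq\<close>, the second with \<open>x\<close> and
      \<open>y\<close> exchanged.\<close>
    by (rule eliminate_series[of _ _ _ _ B]; unfold A_def B_def pow[symmetric]; rule far_series_eq)
qed simp

end
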